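(* If $(\Lambda,d)$ is a source-free $k$-graph with $v\in\Lambda^0$ a sink, then $(\Lambda_S,d_S)$, the graph of $\Lambda$ with the sink $v$ deleted, is a source-free $k$-graph.
   Context: Fix $k\ge1$; $0\in\mathbb{N}$; $e_1,\dots,e_k$ are the standard basis vectors of $\mathbb{N}^k$, and $\mathbb{N}^k$ is regarded as a category with one object, composition being addition. For $n=\sum n_ie_i$, $|n|=\sum n_i$. A $k$-graph is a countable category $\Lambda$ with a functor $d:\Lambda\to\mathbb{N}^k$ satisfying the factorization rule: for every morphism $\lambda$ and $n,m\in\mathbb{N}^k$ with $d(\lambda)=n+m$ there exist unique $\mu,\nu\in\Lambda$ with $d(\mu)=m$, $d(\nu)=n$, $\lambda=\mu\nu$. $\Lambda^n=d^{-1}(n)$; $\Lambda^0$ is the set of vertices (identified with objects); $\Lambda^1=\{\lambda:|d(\lambda)|=1\}$ is the set of edges. $r(\lambda),s(\lambda)\in\Lambda^0$ are the unique vertices with $r(\lambda)\lambda s(\lambda)=\lambda$. A vertex $v$ is a source if $r^{-1}(v)\cap\Lambda^{e_i}=\emptyset$ for some $i$; $\Lambda$ is source-free if it has no sources. A vertex $v$ is an $e_i$ sink if $s^{-1}(v)\cap\Lambda^{e_i}=\emptyset$; it is a sink if it is an $e_i$ sink for some $1\le i\le k$. The 1-skeleton of $\Lambda$ is the directed graph $G=(\Lambda^0,\Lambda^1,r,s)$ with edges colored by $d$. For any $k$-colored directed graph, the path category (denoted by $*$, e.g. $G^*$) consists of all finite paths $f_n\cdots f_1$ with $s(f_i)=r(f_{i-1})$,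 including vertices as paths of length $0$, with range, source and (additively extended) degree. For $\lambda\in G^*$, $[\lambda]\in\Lambda$ denotes the morphism to which $\lambda$ composes. Sink deletion: let $v$ be a sink. Write $w\le v$ if there exists $\lambda\in G^*$ with $s(\lambda)=v$ and $r(\lambda)=w$. Define the $k$-colored graph $G_S=(\Lambda_S^0,\Lambda_S^1,r_S,s_S)$ by $\Lambda_S^0=\{w\in\Lambda^0:w\not\le v\}$, $\Lambda_S^1=\Lambda^1\setminus\{f\in\Lambda^1:r(f)\le v\}$, with $r_S=r$, $s_S=s$, $d_S=d$ (restricted). Let $\iota:G_S^*\to G^*$ be the inclusion and define an equivalence relation on $G_S^*$ by $\mu\sim_S\lambda$ when $[\iota(\mu)]=[\iota(\lambda)]\in\Lambda$. Then $\Lambda_S=G_S^*/\sim_S$, with composition induced by concatenation and degree map induced by $d_S$, is the graph of $\Lambda$ with the sink $v$ deleted. *)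

theory Defs
  imports "HOL-Analysis.Finite_Cartesian_Product" "HOL-Library.Countable_Set"
begin

section \<open>Small categories and functors\<close>

text \<open>
  \<open>Comp C f g\<close> is the composite \<open>f g\<close> (first \<open>g\<close>, then \<open>f\<close>). It is only meaningful when
  \<open>Dom C f = Cod C g\<close>; likewise the other operations are only constrained on \<open>Obj C\<close> and \<open>Mor C\<close>.
\<close>

record ('o, 'm) cat =
  Obj :: "'o set"
  Mor :: "'m set"
  Dom :: "'m \<Rightarrow> 'o"
  Cod :: "'m \<Rightarrow> 'o"
  Ident :: "'o \<Rightarrow> 'm"
  Comp :: "'m \<Rightarrow> 'm \<Rightarrow> 'm"

locale category =
  fixes C :: "('o, 'm) cat"
  assumes Dom_in: "f \<in> Mor C \<Longrightarrow> Dom C f \<in> Obj C"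
    and Cod_in: "f \<in> Mor C \<Longrightarrow> Cod C f \<in> Obj C"
    and Ident_in: "a \<in> Obj C \<Longrightarrow> Ident C a \<in> Mor C"
    and Dom_Ident: "a \<in> Obj C \<Longrightarrow> Dom C (Ident C a) = a"
    and Cod_Ident: "a \<in> Obj C \<Longrightarrow> Cod C (Ident C a) = a"
    and Comp_in: "\<lbrakk>f \<in> Mor C; g \<in> Mor C; Dom C f = Cod C g\<rbrakk> \<Longrightarrow> Comp C f g \<in> Mor C"
    and Dom_Comp: "\<lbrakk>f \<in> Mor C; g \<in> Mor C; Dom C f = Cod C g\<rbrakk> \<Longrightarrow> Dom C (Comp C f g) = Dom C g"
    and Cod_Comp: "\<lbrakk>f \<in> Mor C; g \<in> Mor C; Dom C f = Cod C g\<rbrakk> \<Longrightarrow> Cod C (Comp C f g) = Cod C f"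
    and Comp_Ident_left: "f \<in> Mor C \<Longrightarrow> Comp C (Ident C (Cod C f)) f = f"
    and Comp_Ident_right: "f \<in> Mor C \<Longrightarrow> Comp C f (Ident C (Dom C f)) = f"
    and Comp_assoc: "\<lbrakk>f \<in> Mor C; g \<in> Mor C; h \<in> Mor C; Dom C f = Cod C g; Dom C g = Cod C h\<rbrakk>
      \<Longrightarrow> Comp C (Comp C f g) h = Comp C f (Comp C g h)"

locale cat_functor = C: category C + D: category D
  for C :: "('o, 'm) cat" and D :: "('p, 'n) cat" +
  fixes Fo :: "'o \<Rightarrow> 'p" and Fm :: "'m \<Rightarrow> 'n"
  assumes Fo_in: "a \<in> Obj C \<Longrightarrow> Fo a \<in> Obj D"
    and Fm_in: "f \<in> Mor C \<Longrightarrow> Fm f \<in> Mor D"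
    and Dom_Fm: "f \<in> Mor C \<Longrightarrow> Dom D (Fm f) = Fo (Dom C f)"
    and Cod_Fm: "f \<in> Mor C \<Longrightarrow> Cod D (Fm f) = Fo (Cod C f)"
    and Fm_Ident: "a \<in> Obj C \<Longrightarrow> Fm (Ident C a) = Ident D (Fo a)"
    and Fm_Comp: "\<lbrakk>f \<in> Mor C; g \<in> Mor C; Dom C f = Cod C g\<rbrakk>
      \<Longrightarrow> Fm (Comp C f g) = Comp D (Fm f) (Fm g)"

definition Nk_cat :: "(unit, nat ^ 'k) cat" where
  "Nk_cat = \<lparr>Obj = {()}, Mor = UNIV, Dom = (\<lambda>_. ()), Cod = (\<lambda>_. ()), Ident = (\<lambda>_. 0), Comp = (+)\<rparr>"

text \<open>
  Quotient of a category by an equivalence relation on morphisms that respects domain, codomain and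
  composition; the objects are kept. On classes, \<open>the_elem\<close> picks the value common to all
  representatives.
\<close>

definition quotient_cat :: "('o, 'm) cat \<Rightarrow> ('m \<times> 'm) set \<Rightarrow> ('o, 'm set) cat" where
  "quotient_cat C R =
    \<lparr>Obj = Obj C,
     Mor = Mor C // R,
     Dom = (\<lambda>X. the_elem (Dom C ` X)),
     Cod = (\<lambda>X. the_elem (Cod C ` X)),
     Ident = (\<lambda>a. R `` {Ident C a}),
     Comp = (\<lambda>X Y. \<Union>x\<in>X. \<Union>y\<in>Y. R `` {Comp C x y})\<rparr>"

section \<open>Higher-rank graphs\<close>

text \<open>
  The rank \<open>k \<ge> 1\<close> is the cardinality of the finite index type \<open>'k\<close>; the standard basis vector
  \<open>e\<^sub>i\<close> is \<open>axis i 1\<close>.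
\<close>

definition deg_size :: "nat ^ 'k \<Rightarrow> nat" where
  "deg_size n = (\<Sum>i\<in>UNIV. n $ i)"

locale k_graph = cat_functor \<Lambda> Nk_cat "\<lambda>_. ()" d
  for \<Lambda> :: "('o, 'm) cat" and d :: "'m \<Rightarrow> nat ^ 'k" +
  assumes countable_Obj: "countable (Obj \<Lambda>)"
    and countable_Mor: "countable (Mor \<Lambda>)"
    and factorization: "\<lbrakk>l \<in> Mor \<Lambda>; d l = n + m\<rbrakk> \<Longrightarrow>
      \<exists>!p. case p of (\<mu>, \<nu>) \<Rightarrow> \<mu> \<in> Mor \<Lambda> \<and> \<nu> \<in> Mor \<Lambda> \<and> d \<mu> = m \<and> d \<nu> = n \<and>
        Dom \<Lambda> \<mu> = Cod \<Lambda> \<nu> \<and> l = Comp \<Lambda> \<mu> \<nu>"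

text \<open>
  A vertex is represented by an object. This matches the description of vertices as the morphisms
  of degree zero, because the identity morphisms are exactly those.
\<close>

lemma (in k_graph) bij_betw_Ident_degree_zero:
  "bij_betw (Ident \<Lambda>) (Obj \<Lambda>) {l \<in> Mor \<Lambda>. d l = 0}"
proof (rule bij_betwI[where g = "Dom \<Lambda>"])
  have d0: "d (Ident \<Lambda> a) = 0" if "a \<in> Obj \<Lambda>" for a
    using Fm_Ident[OF that] by (simp add: Nk_cat_def)
  show "Ident \<Lambda> \<in> Obj \<Lambda> \<rightarrow> {l \<in> Mor \<Lambda>. d l = 0}"
    using d0 C.Ident_in by auto
  show "Dom \<Lambda> \<in> {l \<in> Mor \<Lambda>. d l = 0} \<rightarrow> Obj \<Lambda>"
    using C.Dom_in by auto
  show "Dom \<Lambda> (Ident \<Lambda> a) = a" if "a \<in> Obj \<Lambda>" for a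
    using C.Dom_Ident[OF that] .
  show "Ident \<Lambda> (Dom \<Lambda> l) = l" if "l \<in> {l \<in> Mor \<Lambda>. d l = 0}" for l
  proof -
    have l: "l \<in> Mor \<Lambda>" "d l = 0 + 0" using that by auto
    let ?P = "\<lambda>(\<mu>, \<nu>). \<mu> \<in> Mor \<Lambda> \<and> \<nu> \<in> Mor \<Lambda> \<and> d \<mu> = 0 \<and> d \<nu> = 0 \<and>
        Dom \<Lambda> \<mu> = Cod \<Lambda> \<nu> \<and> l = Comp \<Lambda> \<mu> \<nu>"
    have "?P (Ident \<Lambda> (Cod \<Lambda> l), l)" "?P (l, Ident \<Lambda> (Dom \<Lambda> l))"
      using l d0 C.Ident_in C.Dom_in C.Cod_in C.Dom_Ident C.Cod_Ident
        C.Comp_Ident_left C.Comp_Ident_right by auto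
    moreover have "\<exists>!p. ?P p" using factorization[OF l] .
    ultimately have "(Ident \<Lambda> (Cod \<Lambda> l), l) = (l, Ident \<Lambda> (Dom \<Lambda> l))" by blast
    then show ?thesis by simp
  qed
qed

definition is_source :: "('o, 'm) cat \<Rightarrow> ('m \<Rightarrow> nat ^ 'k) \<Rightarrow> 'o \<Rightarrow> bool" where
  "is_source \<Lambda> d v \<longleftrightarrow> (\<exists>i. {l \<in> Mor \<Lambda>. Cod \<Lambda> l = v \<and> d l = axis i 1} = {})"

definition source_free :: "('o, 'm) cat \<Rightarrow> ('m \<Rightarrow> nat ^ 'k) \<Rightarrow> bool" where
  "source_free \<Lambda> d \<longleftrightarrow> (\<forall>v\<in>Obj \<Lambda>. \<not> is_source \<Lambda> d v)"

definition is_dir_sink :: "('o, 'm) cat \<Rightarrow> ('m \<Rightarrow> nat ^ 'k) \<Rightarrow> 'k \<Rightarrow> 'o \<Rightarrow> bool" where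
  "is_dir_sink \<Lambda> d i v \<longleftrightarrow> {l \<in> Mor \<Lambda>. Dom \<Lambda> l = v \<and> d l = axis i 1} = {}"

definition is_sink :: "('o, 'm) cat \<Rightarrow> ('m \<Rightarrow> nat ^ 'k) \<Rightarrow> 'o \<Rightarrow> bool" where
  "is_sink \<Lambda> d v \<longleftrightarrow> (\<exists>i. is_dir_sink \<Lambda> d i v)"

section \<open>Coloured directed graphs and their path categories\<close>

record ('v, 'e, 'k) cgraph =
  verts :: "'v set"
  edges :: "'e set"
  rng :: "'e \<Rightarrow> 'v"
  src :: "'e \<Rightarrow> 'v"
  colour :: "'e \<Rightarrow> nat ^ 'k"

locale coloured_graph =
  fixes G :: "('v, 'e, 'k::finite) cgraph"
  assumes rng_in: "f \<in> edges G \<Longrightarrow> rng G f \<in> verts G"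
    and src_in: "f \<in> edges G \<Longrightarrow> src G f \<in> verts G"
    and colour_in: "f \<in> edges G \<Longrightarrow> colour G f \<in> range (\<lambda>i. axis i 1)"

text \<open>
  The path \<open>f\<^sub>n \<dots> f\<^sub>1\<close> is encoded as the pair of its range \<open>r(f\<^sub>n)\<close> and the list
  \<open>[f\<^sub>n, \<dots>, f\<^sub>1]\<close>; the vertex \<open>v\<close>, as a path of length zero, is \<open>(v, [])\<close>.
\<close>

type_synonym ('v, 'e) gpath = "'v \<times> 'e list"

fun walk :: "('v, 'e, 'k::finite) cgraph \<Rightarrow> 'v \<Rightarrow> 'e list \<Rightarrow> bool" where
  "walk G v [] \<longleftrightarrow> v \<in> verts G"
| "walk G v (f # fs) \<longleftrightarrow> f \<in> edges G \<and> rng G f = v \<and> walk G (src G f) fs"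

definition path_rng :: "('v, 'e) gpath \<Rightarrow> 'v" where
  "path_rng p = fst p"

definition path_src :: "('v, 'e, 'k::finite) cgraph \<Rightarrow> ('v, 'e) gpath \<Rightarrow> 'v" where
  "path_src G p = (if snd p = [] then fst p else src G (last (snd p)))"

definition path_deg :: "('v, 'e, 'k::finite) cgraph \<Rightarrow> ('v, 'e) gpath \<Rightarrow> nat ^ 'k" where
  "path_deg G p = sum_list (map (colour G) (snd p))"

definition path_cat :: "('v, 'e, 'k::finite) cgraph \<Rightarrow> ('v, ('v, 'e) gpath) cat" where
  "path_cat G =
    \<lparr>Obj = verts G,
     Mor = {(v, fs). walk G v fs},
     Dom = path_src G,
     Cod = path_rng,
     Ident = (\<lambda>v. (v, [])),
     Comp = (\<lambda>p q. (fst p, snd p @ snd q))\<rparr>"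

definition one_skeleton ::
    "('o, 'm) cat \<Rightarrow> ('m \<Rightarrow> nat ^ 'k) \<Rightarrow> ('o, 'm, 'k::finite) cgraph" where
  "one_skeleton \<Lambda> d =
    \<lparr>verts = Obj \<Lambda>,
     edges = {l \<in> Mor \<Lambda>. deg_size (d l) = 1},
     rng = Cod \<Lambda>,
     src = Dom \<Lambda>,
     colour = d\<rparr>"

text \<open>The morphism \<open>[p]\<close> to which a path \<open>p\<close> in the 1-skeleton composes.\<close>

fun path_eval :: "('o, 'm) cat \<Rightarrow> ('o, 'm) gpath \<Rightarrow> 'm" where
  "path_eval \<Lambda> (v, []) = Ident \<Lambda> v"
| "path_eval \<Lambda> (v, f # fs) = Comp \<Lambda> f (path_eval \<Lambda> (Dom \<Lambda> f, fs))"

section \<open>Sink deletion\<close>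

definition below ::
    "('o, 'm) cat \<Rightarrow> ('m \<Rightarrow> nat ^ 'k::finite) \<Rightarrow> 'o \<Rightarrow> 'o \<Rightarrow> bool" where
  "below \<Lambda> d w v \<longleftrightarrow>
    (\<exists>\<nu> \<in> Mor (path_cat (one_skeleton \<Lambda> d)).
      path_src (one_skeleton \<Lambda> d) \<nu> = v \<and> path_rng \<nu> = w)"

definition sink_del_skeleton ::
    "('o, 'm) cat \<Rightarrow> ('m \<Rightarrow> nat ^ 'k) \<Rightarrow> 'o \<Rightarrow> ('o, 'm, 'k::finite) cgraph" where
  "sink_del_skeleton \<Lambda> d v =
    (let G = one_skeleton \<Lambda> d in
    \<lparr>verts = {w \<in> verts G. \<not> below \<Lambda> d w v},
     edges = edges G - {f \<in> edges G. below \<Lambda> d (rng G f) v},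
     rng = rng G,
     src = src G,
     colour = colour G\<rparr>)"

text \<open>
  A path in \<open>sink_del_skeleton\<close> is literally a path in \<open>one_skeleton\<close> (see
  \<open>sink_del_path_in_skeleton\<close> below), so no inclusion map appears.
\<close>

definition sink_del_equiv ::
    "('o, 'm) cat \<Rightarrow> ('m \<Rightarrow> nat ^ 'k::finite) \<Rightarrow> 'o \<Rightarrow> (('o, 'm) gpath \<times> ('o, 'm) gpath) set" where
  "sink_del_equiv \<Lambda> d v =
    {(\<mu>, \<nu>). \<mu> \<in> Mor (path_cat (sink_del_skeleton \<Lambda> d v)) \<and>
      \<nu> \<in> Mor (path_cat (sink_del_skeleton \<Lambda> d v)) \<and>
      path_eval \<Lambda> \<mu> = path_eval \<Lambda> \<nu>}"

definition sink_del ::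
    "('o, 'm) cat \<Rightarrow> ('m \<Rightarrow> nat ^ 'k::finite) \<Rightarrow> 'o \<Rightarrow> ('o, ('o, 'm) gpath set) cat" where
  "sink_del \<Lambda> d v =
    quotient_cat (path_cat (sink_del_skeleton \<Lambda> d v)) (sink_del_equiv \<Lambda> d v)"

definition sink_del_degree ::
    "('o, 'm) cat \<Rightarrow> ('m \<Rightarrow> nat ^ 'k::finite) \<Rightarrow> 'o \<Rightarrow> ('o, 'm) gpath set \<Rightarrow> nat ^ 'k" where
  "sink_del_degree \<Lambda> d v X = the_elem (path_deg (sink_del_skeleton \<Lambda> d v) ` X)"

section \<open>Well-definedness of sink deletion\<close>

lemma deg_size_eq_1: "deg_size (n :: nat ^ 'k) = 1 \<longleftrightarrow> n \<in> range (\<lambda>i. axis i 1)"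
proof
  assume "deg_size n = 1"
  then have "\<exists>i\<in>UNIV. n $ i = 1 \<and> (\<forall>j\<in>UNIV. i \<noteq> j \<longrightarrow> n $ j = 0)"
    using sum_eq_1_iff[of UNIV "\<lambda>i. n $ i"] by (simp add: deg_size_def)
  then obtain i where i: "n $ i = 1" "\<And>j. j \<noteq> i \<Longrightarrow> n $ j = 0" by auto
  then have "n = axis i 1" by (simp add: vec_eq_iff axis_def)
  then show "n \<in> range (\<lambda>i. axis i 1)" by auto
next
  assume "n \<in> range (\<lambda>i. axis i 1)"
  then show "deg_size n = 1" by (auto simp: deg_size_def axis_def)
qed

lemma sink_del_path_in_skeleton:
  assumes "p \<in> Mor (path_cat (sink_del_skeleton \<Lambda> d v))"
  shows "p \<in> Mor (path_cat (one_skeleton \<Lambda> d))"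
proof -
  have "walk (one_skeleton \<Lambda> d) w fs" if "walk (sink_del_skeleton \<Lambda> d v) w fs" for w fs
    using that by (induction fs arbitrary: w) (auto simp: sink_del_skeleton_def Let_def)
  then show ?thesis using assms by (auto simp: path_cat_def)
qed

lemma category_path_cat:
  assumes "coloured_graph G" shows "category (path_cat G)"
proof -
  interpret coloured_graph G by fact
  have hd: "v \<in> verts G" if "walk G v fs" for v fs
    using that rng_in by (cases fs) auto
  have sr: "path_src G (v, fs) \<in> verts G" if "walk G v fs" for v fs
    using that src_in by (induction fs arbitrary: v) (auto simp: path_src_def split: if_splits)
  have cc: "walk G v (fs @ gs)" if "walk G v fs" "walk G (path_src G (v, fs)) gs" for v fs gs
    using that by (induction fs arbitrary: v) (auto simp: path_src_def split: if_splits)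
  show ?thesis
    by unfold_locales
      (auto simp: path_cat_def path_rng_def hd sr cc, auto simp: path_src_def)
qed

context k_graph
begin

lemma coloured_graph_one_skeleton: "coloured_graph (one_skeleton \<Lambda> d)"
  by unfold_locales (simp_all add: one_skeleton_def deg_size_eq_1 C.Dom_in C.Cod_in del: One_nat_def)

lemma coloured_graph_sink_del_skeleton: "coloured_graph (sink_del_skeleton \<Lambda> d v)"
proof unfold_locales
  fix f assume f: "f \<in> edges (sink_del_skeleton \<Lambda> d v)"
  then have fe: "f \<in> edges (one_skeleton \<Lambda> d)" and nb: "\<not> below \<Lambda> d (Cod \<Lambda> f) v"
    by (auto simp: sink_del_skeleton_def one_skeleton_def)
  have ff: "f \<in> Mor \<Lambda>" "d f \<in> range (\<lambda>i. axis i 1)"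
    using fe by (simp_all add: one_skeleton_def deg_size_eq_1 del: One_nat_def)
  show "rng (sink_del_skeleton \<Lambda> d v) f \<in> verts (sink_del_skeleton \<Lambda> d v)"
    using ff nb C.Cod_in by (auto simp: sink_del_skeleton_def one_skeleton_def)
  show "colour (sink_del_skeleton \<Lambda> d v) f \<in> range (\<lambda>i. axis i 1)"
    using ff by (auto simp: sink_del_skeleton_def one_skeleton_def)
  have "\<not> below \<Lambda> d (Dom \<Lambda> f) v"
  proof
    assume "below \<Lambda> d (Dom \<Lambda> f) v"
    then obtain gs where gs: "walk (one_skeleton \<Lambda> d) (Dom \<Lambda> f) gs"
        "path_src (one_skeleton \<Lambda> d) (Dom \<Lambda> f, gs) = v"
      by (auto simp: below_def path_cat_def path_rng_def)
    have "walk (one_skeleton \<Lambda> d) (Cod \<Lambda> f) (f # gs)"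
      using gs fe by (auto simp: one_skeleton_def)
    moreover have "path_src (one_skeleton \<Lambda> d) (Cod \<Lambda> f, f # gs) = v"
      using gs by (auto simp: path_src_def one_skeleton_def)
    ultimately have "below \<Lambda> d (Cod \<Lambda> f) v"
      by (force simp: below_def path_cat_def path_rng_def)
    then show False using nb by simp
  qed
  then show "src (sink_del_skeleton \<Lambda> d v) f \<in> verts (sink_del_skeleton \<Lambda> d v)"
    using ff C.Dom_in by (auto simp: sink_del_skeleton_def one_skeleton_def)
qed

lemma path_eval_walk:
  assumes "walk (one_skeleton \<Lambda> d) v fs"
  shows "path_eval \<Lambda> (v, fs) \<in> Mor \<Lambda> \<and> Cod \<Lambda> (path_eval \<Lambda> (v, fs)) = v \<and>
    Dom \<Lambda> (path_eval \<Lambda> (v, fs)) = path_src (one_skeleton \<Lambda> d) (v, fs) \<and>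
    d (path_eval \<Lambda> (v, fs)) = path_deg (one_skeleton \<Lambda> d) (v, fs)"
  using assms
proof (induction fs arbitrary: v)
  case Nil
  then show ?case using Fm_Ident[of v]
    by (auto simp: one_skeleton_def path_src_def path_deg_def Nk_cat_def
        C.Ident_in C.Dom_Ident C.Cod_Ident)
next
  case (Cons f fs)
  have f: "f \<in> Mor \<Lambda>" "Cod \<Lambda> f = v" and w: "walk (one_skeleton \<Lambda> d) (Dom \<Lambda> f) fs"
    using Cons.prems by (auto simp: one_skeleton_def)
  note IH = Cons.IH[OF w]
  have "d (Comp \<Lambda> f (path_eval \<Lambda> (Dom \<Lambda> f, fs))) = d f + d (path_eval \<Lambda> (Dom \<Lambda> f, fs))"
    using Fm_Comp[of f "path_eval \<Lambda> (Dom \<Lambda> f, fs)"] f IH by (simp add: Nk_cat_def)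
  then show ?case using f IH
    by (auto simp: C.Comp_in C.Dom_Comp C.Cod_Comp path_src_def path_deg_def one_skeleton_def)
qed

lemma path_eval_append:
  assumes "walk (one_skeleton \<Lambda> d) v fs"
    and "walk (one_skeleton \<Lambda> d) (path_src (one_skeleton \<Lambda> d) (v, fs)) gs"
  shows "path_eval \<Lambda> (v, fs @ gs) =
    Comp \<Lambda> (path_eval \<Lambda> (v, fs))
      (path_eval \<Lambda> (path_src (one_skeleton \<Lambda> d) (v, fs), gs))"
  using assms
proof (induction fs arbitrary: v)
  case Nil
  then show ?case using path_eval_walk[of v gs] C.Comp_Ident_left[of "path_eval \<Lambda> (v, gs)"]
    by (auto simp: path_src_def)
next
  case (Cons f fs)
  let ?G = "one_skeleton \<Lambda> d"
  have f: "f \<in> Mor \<Lambda>" and w: "walk ?G (Dom \<Lambda> f) fs"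
    using Cons.prems by (auto simp: one_skeleton_def)
  have s: "path_src ?G (v, f # fs) = path_src ?G (Dom \<Lambda> f, fs)"
    by (auto simp: path_src_def one_skeleton_def)
  show ?case
    using Cons.IH[OF w] Cons.prems(2) f path_eval_walk[OF w] path_eval_walk[OF Cons.prems(2)]
    by (simp add: s C.Comp_assoc)
qed

lemma equiv_sink_del_equiv:
  "equiv (Mor (path_cat (sink_del_skeleton \<Lambda> d v))) (sink_del_equiv \<Lambda> d v)"
  by (rule equivI) (auto simp: sink_del_equiv_def refl_on_def sym_def trans_def)

lemma sink_del_equiv_respects:
  assumes "(\<mu>, \<nu>) \<in> sink_del_equiv \<Lambda> d v"
  shows "path_rng \<mu> = path_rng \<nu>"
    and "path_src (sink_del_skeleton \<Lambda> d v) \<mu> = path_src (sink_del_skeleton \<Lambda> d v) \<nu>"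
    and "path_deg (sink_del_skeleton \<Lambda> d v) \<mu> = path_deg (sink_del_skeleton \<Lambda> d v) \<nu>"
proof -
  have eq: "path_eval \<Lambda> \<mu> = path_eval \<Lambda> \<nu>"
    and "\<mu> \<in> Mor (path_cat (one_skeleton \<Lambda> d))" "\<nu> \<in> Mor (path_cat (one_skeleton \<Lambda> d))"
    using assms by (auto simp: sink_del_equiv_def intro: sink_del_path_in_skeleton)
  then have w: "walk (one_skeleton \<Lambda> d) (fst \<mu>) (snd \<mu>)" "walk (one_skeleton \<Lambda> d) (fst \<nu>) (snd \<nu>)"
    by (auto simp: path_cat_def)
  note e = path_eval_walk[OF w(1)] path_eval_walk[OF w(2)]
  have src_eq: "path_src (sink_del_skeleton \<Lambda> d v) p = path_src (one_skeleton \<Lambda> d) p"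
    for p :: "('o, 'm) gpath"
    by (simp add: path_src_def sink_del_skeleton_def Let_def)
  show "path_rng \<mu> = path_rng \<nu>" using e eq by (simp add: path_rng_def)
  show "path_src (sink_del_skeleton \<Lambda> d v) \<mu> = path_src (sink_del_skeleton \<Lambda> d v) \<nu>"
    using e eq src_eq[of \<mu>] src_eq[of \<nu>] by simp
  show "path_deg (sink_del_skeleton \<Lambda> d v) \<mu> = path_deg (sink_del_skeleton \<Lambda> d v) \<nu>"
    using e eq by (simp add: path_deg_def sink_del_skeleton_def Let_def)
qed

lemma sink_del_equiv_Comp:
  fixes v :: 'o
  defines "P \<equiv> path_cat (sink_del_skeleton \<Lambda> d v)"
  assumes "(\<mu>, \<mu>') \<in> sink_del_equiv \<Lambda> d v" "(\<nu>, \<nu>') \<in> sink_del_equiv \<Lambda> d v"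
    and c: "Dom P \<mu> = Cod P \<nu>"
  shows "(Comp P \<mu> \<nu>, Comp P \<mu>' \<nu>') \<in> sink_del_equiv \<Lambda> d v"
proof -
  let ?G = "one_skeleton \<Lambda> d" and ?S = "sink_del_skeleton \<Lambda> d v"
  interpret P: category P
    unfolding P_def using category_path_cat coloured_graph_sink_del_skeleton by blast
  have src_eq: "path_src ?S p = path_src ?G p" for p :: "('o, 'm) gpath"
    by (simp add: path_src_def sink_del_skeleton_def Let_def)
  have ev: "path_eval \<Lambda> (Comp P p q) = Comp \<Lambda> (path_eval \<Lambda> p) (path_eval \<Lambda> q)"
    if "p \<in> Mor P" "q \<in> Mor P" "Dom P p = Cod P q" for p q
  proof -
    have "walk ?G (fst p) (snd p)" "walk ?G (fst q) (snd q)"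
      using that(1,2) sink_del_path_in_skeleton[of _ \<Lambda> d v] unfolding P_def
      by (auto simp: path_cat_def)
    moreover have "path_src ?G (fst p, snd p) = fst q"
      using that(3) by (simp add: P_def path_cat_def path_rng_def src_eq)
    ultimately show ?thesis
      using path_eval_append[of "fst p" "snd p" "snd q"] by (simp add: P_def path_cat_def)
  qed
  have m: "\<mu> \<in> Mor P" "\<mu>' \<in> Mor P" "\<nu> \<in> Mor P" "\<nu>' \<in> Mor P"
    and e: "path_eval \<Lambda> \<mu> = path_eval \<Lambda> \<mu>'" "path_eval \<Lambda> \<nu> = path_eval \<Lambda> \<nu>'"
    using assms(2,3) by (auto simp: sink_del_equiv_def P_def)
  have c': "Dom P \<mu>' = Cod P \<nu>'"
    using c sink_del_equiv_respects[OF assms(2)] sink_del_equiv_respects[OF assms(3)]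
    by (simp add: P_def path_cat_def)
  show ?thesis
    using P.Comp_in[OF m(1,3) c] P.Comp_in[OF m(2,4) c'] ev[OF m(1,3) c] ev[OF m(2,4) c'] e
    by (simp add: sink_del_equiv_def P_def)
qed

end

end

theory Submission
  imports Defs
begin

text \<open>
  Call a vertex deleted if it lies below \<open>v\<close>. If the source of a morphism is deleted, then so is its
  range; hence every factor of a morphism with surviving range again has surviving range. The
  morphisms of \<open>\<Lambda>\<close> with surviving range therefore form a full subcategory on the surviving vertices
  that contains the two factors of each of its morphisms and all edges of \<open>\<Lambda>\<close> ending at a
  surviving vertex. Countability, the factorization rule and source-freeness pass from \<open>\<Lambda>\<close> to such a
  subcategory (\<open>k_graph_of_embedding\<close>, \<open>source_free_of_embedding\<close>).

  It remains to identify the quotient of the path category of the reduced skeleton with this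
  subcategory. Evaluation of paths is a functor to \<open>\<Lambda>\<close> that is the identity on vertices, and the
  equivalence relation is by definition its kernel, so that the quotient embeds in \<open>\<Lambda>\<close>
  (\<open>kernel_quotient_functor\<close>, \<open>kernel_quotient_inj\<close>). The image consists of all morphisms with
  surviving range, because every morphism of a \<open>k\<close>-graph is a composite of edges
  (\<open>ex_path_eval\<close>).
\<close>

section \<open>The quotient of a category by the kernel of a functor\<close>

text \<open>The relation that identifies the morphisms of \<open>C\<close> with the same image under \<open>F\<close>.\<close>

definition kernel_rel :: "('o, 'm) cat \<Rightarrow> ('m \<Rightarrow> 'n) \<Rightarrow> ('m \<times> 'm) set" where
  "kernel_rel C F = {(f, g). f \<in> Mor C \<and> g \<in> Mor C \<and> F f = F g}"

lemma kernel_rel_class: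
  "f \<in> Mor C \<Longrightarrow> kernel_rel C F `` {f} = {g \<in> Mor C. F g = F f}"
  by (auto simp: kernel_rel_def)

lemma Mor_kernel_quotientE:
  assumes "X \<in> Mor (quotient_cat C (kernel_rel C F))"
  obtains f where "f \<in> Mor C" "X = kernel_rel C F `` {f}"
  using assms by (auto simp: quotient_cat_def quotient_def)

lemma kernel_class_in_Mor:
  "f \<in> Mor C \<Longrightarrow> kernel_rel C F `` {f} \<in> Mor (quotient_cat C (kernel_rel C F))"
  by (auto simp: quotient_cat_def quotient_def)

lemma the_elem_kernel_class:
  assumes "f \<in> Mor C" and "\<And>g. g \<in> Mor C \<Longrightarrow> F g = F f \<Longrightarrow> h g = h f"
  shows "the_elem (h ` (kernel_rel C F `` {f})) = h f"
proof -
  have "h ` (kernel_rel C F `` {f}) = {h f}"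
    unfolding kernel_rel_class[OF assms(1)] using assms by blast
  then show ?thesis by simp
qed

context cat_functor
begin

text \<open>
  Injectivity of the object map is what makes the kernel respect domains and codomains.
\<close>

lemma kernel_quotient_class:
  assumes "inj_on Fo (Obj C)" and f: "f \<in> Mor C"
  shows "Dom (quotient_cat C (kernel_rel C Fm)) (kernel_rel C Fm `` {f}) = Dom C f"
    and "Cod (quotient_cat C (kernel_rel C Fm)) (kernel_rel C Fm `` {f}) = Cod C f"
    and "the_elem (Fm ` (kernel_rel C Fm `` {f})) = Fm f"
proof -
  have *: "Dom C g = Dom C f \<and> Cod C g = Cod C f" if "g \<in> Mor C" "Fm g = Fm f" for g
    using that f Dom_Fm Cod_Fm C.Dom_in C.Cod_in by (metis assms(1) inj_onD)
  show "Dom (quotient_cat C (kernel_rel C Fm)) (kernel_rel C Fm `` {f}) = Dom C f"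
    and "Cod (quotient_cat C (kernel_rel C Fm)) (kernel_rel C Fm `` {f}) = Cod C f"
    and "the_elem (Fm ` (kernel_rel C Fm `` {f})) = Fm f"
    using * the_elem_kernel_class[OF f, of Fm "Dom C"] the_elem_kernel_class[OF f, of Fm "Cod C"]
      the_elem_kernel_class[OF f, of Fm Fm]
    by (simp_all add: quotient_cat_def)
qed

lemma kernel_quotient_Comp:
  assumes inj: "inj_on Fo (Obj C)"
    and fg: "f \<in> Mor C" "g \<in> Mor C" "Dom C f = Cod C g"
  shows "Comp (quotient_cat C (kernel_rel C Fm)) (kernel_rel C Fm `` {f}) (kernel_rel C Fm `` {g})
    = kernel_rel C Fm `` {Comp C f g}"
proof -
  have *: "kernel_rel C Fm `` {Comp C x y} = kernel_rel C Fm `` {Comp C f g}"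
    if x: "x \<in> Mor C" "Fm x = Fm f" and y: "y \<in> Mor C" "Fm y = Fm g" for x y
  proof -
    have "Fo (Dom C x) = Fo (Cod C y)"
      using x y fg Dom_Fm Cod_Fm by metis
    then have c: "Dom C x = Cod C y"
      using inj x y C.Dom_in C.Cod_in by (simp add: inj_on_eq_iff)
    show ?thesis
      using x y fg c by (simp add: kernel_rel_class C.Comp_in Fm_Comp)
  qed
  have mem: "f \<in> kernel_rel C Fm `` {f}" "g \<in> kernel_rel C Fm `` {g}"
    using fg by (simp_all add: kernel_rel_class)
  have "kernel_rel C Fm `` {Comp C x y} = kernel_rel C Fm `` {Comp C f g}"
    if "x \<in> kernel_rel C Fm `` {f}" "y \<in> kernel_rel C Fm `` {g}" for x y
    using that fg by (intro *) (simp_all add: kernel_rel_class)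
  then have "(\<Union>x\<in>kernel_rel C Fm `` {f}. \<Union>y\<in>kernel_rel C Fm `` {g}.
      kernel_rel C Fm `` {Comp C x y}) =
    (\<Union>x\<in>kernel_rel C Fm `` {f}. \<Union>y\<in>kernel_rel C Fm `` {g}.
      kernel_rel C Fm `` {Comp C f g})"
    by (intro SUP_cong refl)
  also have "\<dots> = kernel_rel C Fm `` {Comp C f g}"
    using mem by blast
  finally show ?thesis by (simp add: quotient_cat_def)
qed

lemma kernel_quotient_functor:
  assumes inj: "inj_on Fo (Obj C)"
  shows "cat_functor (quotient_cat C (kernel_rel C Fm)) D Fo (\<lambda>X. the_elem (Fm ` X))"
proof -
  let ?Q = "quotient_cat C (kernel_rel C Fm)"
  note cls = kernel_quotient_class[OF inj] kernel_quotient_Comp[OF inj] kernel_class_in_Mor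
  have ObjQ: "Obj ?Q = Obj C" by (simp add: quotient_cat_def)
  have IdQ: "Ident ?Q a = kernel_rel C Fm `` {Ident C a}" for a
    by (simp add: quotient_cat_def)
  show ?thesis
  proof unfold_locales
    fix f g h assume "f \<in> Mor ?Q" "g \<in> Mor ?Q" "h \<in> Mor ?Q"
      and c: "Dom ?Q f = Cod ?Q g" "Dom ?Q g = Cod ?Q h"
    then obtain f' g' h' where m: "f' \<in> Mor C" "g' \<in> Mor C" "h' \<in> Mor C"
      and e: "f = kernel_rel C Fm `` {f'}" "g = kernel_rel C Fm `` {g'}"
        "h = kernel_rel C Fm `` {h'}"
      by (elim Mor_kernel_quotientE) simp
    show "Comp ?Q (Comp ?Q f g) h = Comp ?Q f (Comp ?Q g h)"
      using m c unfolding e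
      by (simp add: cls C.Comp_in C.Dom_Comp C.Cod_Comp C.Comp_assoc)
  next
    fix f g assume "f \<in> Mor ?Q" "g \<in> Mor ?Q" and c: "Dom ?Q f = Cod ?Q g"
    then obtain f' g' where m: "f' \<in> Mor C" "g' \<in> Mor C"
      and e: "f = kernel_rel C Fm `` {f'}" "g = kernel_rel C Fm `` {g'}"
      by (elim Mor_kernel_quotientE) simp
    have c': "Dom C f' = Cod C g'" using c m by (simp add: e cls)
    show "Comp ?Q f g \<in> Mor ?Q" "Dom ?Q (Comp ?Q f g) = Dom ?Q g"
      "Cod ?Q (Comp ?Q f g) = Cod ?Q f"
      "the_elem (Fm ` Comp ?Q f g) = Comp D (the_elem (Fm ` f)) (the_elem (Fm ` g))"
      using m c' unfolding e
      by (simp_all add: cls C.Comp_in C.Dom_Comp C.Cod_Comp Fm_Comp)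
  next
    fix f assume "f \<in> Mor ?Q"
    then obtain f' where m: "f' \<in> Mor C" and e: "f = kernel_rel C Fm `` {f'}"
      by (rule Mor_kernel_quotientE)
    show "Dom ?Q f \<in> Obj ?Q" "Cod ?Q f \<in> Obj ?Q"
      "Comp ?Q (Ident ?Q (Cod ?Q f)) f = f" "Comp ?Q f (Ident ?Q (Dom ?Q f)) = f"
      "the_elem (Fm ` f) \<in> Mor D"
      "Dom D (the_elem (Fm ` f)) = Fo (Dom ?Q f)" "Cod D (the_elem (Fm ` f)) = Fo (Cod ?Q f)"
      using m unfolding e
      by (simp_all add: cls ObjQ IdQ C.Dom_in C.Cod_in C.Ident_in C.Dom_Ident C.Cod_Ident
          C.Comp_Ident_left C.Comp_Ident_right Fm_in Dom_Fm Cod_Fm)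
  next
    fix a assume "a \<in> Obj ?Q"
    then show "Ident ?Q a \<in> Mor ?Q" "Dom ?Q (Ident ?Q a) = a" "Cod ?Q (Ident ?Q a) = a"
      "Fo a \<in> Obj D" "the_elem (Fm ` Ident ?Q a) = Ident D (Fo a)"
      by (simp_all add: cls ObjQ IdQ C.Ident_in C.Dom_Ident C.Cod_Ident Fo_in Fm_Ident)
  qed
qed

lemma kernel_quotient_inj:
  assumes "inj_on Fo (Obj C)"
  shows "inj_on (\<lambda>X. the_elem (Fm ` X)) (Mor (quotient_cat C (kernel_rel C Fm)))"
proof (rule inj_onI, elim Mor_kernel_quotientE)
  fix X Y f g assume "the_elem (Fm ` X) = the_elem (Fm ` Y)"
    and "f \<in> Mor C" "X = kernel_rel C Fm `` {f}" "g \<in> Mor C" "Y = kernel_rel C Fm `` {g}"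
  then show "X = Y"
    using kernel_quotient_class(3)[OF assms] by (simp add: kernel_rel_class)
qed

lemma kernel_quotient_image:
  assumes "inj_on Fo (Obj C)"
  shows "(\<lambda>X. the_elem (Fm ` X)) ` Mor (quotient_cat C (kernel_rel C Fm)) = Fm ` Mor C"
proof -
  have "Mor (quotient_cat C (kernel_rel C Fm)) = (\<lambda>f. kernel_rel C Fm `` {f}) ` Mor C"
    by (auto simp: quotient_cat_def quotient_def)
  then show ?thesis
    by (simp add: image_image kernel_quotient_class[OF assms] cong: image_cong)
qed

end

section \<open>Hereditary subgraphs of a k-graph\<close>

text \<open>
  Suppose that the morphisms in the image of \<open>F\<close> are exactly those whose codomain lies in the image
  of \<open>Fo\<close>. Then the factors of such a morphism are again in the image: the left factor has the same
  codomain, and the codomain of the right factor is the domain of the left one. So if \<open>F\<close> is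
  injective, the unique factorizations in \<open>\<Lambda>\<close> lift to \<open>C\<close>.
\<close>

lemma (in k_graph) k_graph_of_embedding:
  assumes "cat_functor C \<Lambda> Fo F"
    and injo: "inj_on Fo (Obj C)" and inj: "inj_on F (Mor C)"
    and img: "F ` Mor C = {l \<in> Mor \<Lambda>. Cod \<Lambda> l \<in> Fo ` Obj C}"
    and deg: "\<And>x. x \<in> Mor C \<Longrightarrow> d' x = d (F x)"
  shows "k_graph C d'"
proof -
  interpret F: cat_functor C \<Lambda> Fo F by fact
  have comp_iff: "Dom \<Lambda> (F x) = Cod \<Lambda> (F y) \<longleftrightarrow> Dom C x = Cod C y"
    if "x \<in> Mor C" "y \<in> Mor C" for x y
    using that injo F.C.Dom_in F.C.Cod_in by (simp add: F.Dom_Fm F.Cod_Fm inj_on_eq_iff)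
  have "F ` Mor C \<subseteq> Mor \<Lambda>" "Fo ` Obj C \<subseteq> Obj \<Lambda>"
    using F.Fm_in F.Fo_in by auto
  then have count: "countable (Obj C)" "countable (Mor C)"
    using countable_Obj countable_Mor injo inj
    by (meson countable_image_inj_on countable_subset)+
  show ?thesis
  proof unfold_locales
    fix l n m assume l: "l \<in> Mor C" "d' l = n + m"
    let ?P = "\<lambda>\<mu> \<nu>. \<mu> \<in> Mor \<Lambda> \<and> \<nu> \<in> Mor \<Lambda> \<and> d \<mu> = m \<and> d \<nu> = n \<and>
      Dom \<Lambda> \<mu> = Cod \<Lambda> \<nu> \<and> F l = Comp \<Lambda> \<mu> \<nu>"
    let ?Q = "\<lambda>\<mu> \<nu>. \<mu> \<in> Mor C \<and> \<nu> \<in> Mor C \<and> d' \<mu> = m \<and> d' \<nu> = n \<and>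
      Dom C \<mu> = Cod C \<nu> \<and> l = Comp C \<mu> \<nu>"
    have ex1: "\<exists>!p. case p of (\<mu>, \<nu>) \<Rightarrow> ?P \<mu> \<nu>"
      using l deg F.Fm_in by (intro factorization) auto
    have QP: "?P (F \<mu>) (F \<nu>)" if "?Q \<mu> \<nu>" for \<mu> \<nu>
      using that by (auto simp: F.Fm_in deg comp_iff F.Fm_Comp)
    obtain \<mu> \<nu> where P: "?P \<mu> \<nu>" using ex1 by auto
    have "Cod \<Lambda> \<mu> = Fo (Cod C l)" using P l C.Cod_Comp F.Cod_Fm by metis
    then have "\<mu> \<in> F ` Mor C" using P l F.C.Cod_in by (simp add: img)
    then obtain x where x: "x \<in> Mor C" "\<mu> = F x" by auto
    have "Cod \<Lambda> \<nu> = Fo (Dom C x)" using P x F.Dom_Fm by metis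
    then have "\<nu> \<in> F ` Mor C" using P x F.C.Dom_in by (simp add: img)
    then obtain y where y: "y \<in> Mor C" "\<nu> = F y" by auto
    have c: "Dom C x = Cod C y" using P x y comp_iff by metis
    have "F l = F (Comp C x y)" using P x y c F.Fm_Comp by metis
    then have "l = Comp C x y"
      using inj l x y c F.C.Comp_in by (simp add: inj_on_eq_iff)
    then have Q: "?Q x y" using x y c P deg by auto
    show "\<exists>!p. case p of (\<mu>, \<nu>) \<Rightarrow> ?Q \<mu> \<nu>"
    proof (rule ex1I[of _ "(x, y)"])
      show "case (x, y) of (\<mu>, \<nu>) \<Rightarrow> ?Q \<mu> \<nu>" using Q by simp
      fix p assume "case p of (\<mu>, \<nu>) \<Rightarrow> ?Q \<mu> \<nu>"
      then obtain x' y' where p: "p = (x', y')" and Q': "?Q x' y'" by (cases p) auto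
      have "(F x', F y') = (F x, F y)" using ex1 QP[OF Q] QP[OF Q'] by blast
      then show "p = (x, y)" using inj Q Q' p by (simp add: inj_on_eq_iff)
    qed
  qed (use count in \<open>simp_all add: Nk_cat_def deg F.Fm_in F.Fm_Ident F.Fm_Comp
        F.C.Ident_in F.C.Comp_in Fm_Ident[unfolded Nk_cat_def] Fm_Comp[unfolded Nk_cat_def]
        F.Fo_in F.Dom_Fm F.Cod_Fm\<close>)
qed

lemma (in k_graph) source_free_of_embedding:
  assumes "cat_functor C \<Lambda> Fo F"
    and injo: "inj_on Fo (Obj C)"
    and img: "F ` Mor C = {l \<in> Mor \<Lambda>. Cod \<Lambda> l \<in> Fo ` Obj C}"
    and deg: "\<And>x. x \<in> Mor C \<Longrightarrow> d' x = d (F x)"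
    and sf: "source_free \<Lambda> d"
  shows "source_free C d'"
  unfolding source_free_def is_source_def
proof (intro ballI notI, elim exE)
  interpret F: cat_functor C \<Lambda> Fo F by fact
  fix w i assume w: "w \<in> Obj C" and none: "{x \<in> Mor C. Cod C x = w \<and> d' x = axis i 1} = {}"
  obtain l where l: "l \<in> Mor \<Lambda>" "Cod \<Lambda> l = Fo w" "d l = axis i 1"
    using sf F.Fo_in[OF w] unfolding source_free_def is_source_def by blast
  then have "l \<in> F ` Mor C" using w by (simp add: img)
  then obtain x where x: "x \<in> Mor C" "l = F x" by auto
  have "Fo (Cod C x) = Fo w" using l x F.Cod_Fm by simp
  then have "Cod C x = w" using injo x w F.C.Cod_in by (simp add: inj_on_eq_iff)
  then show False using none x l deg by auto
qed

section \<open>Evaluation of paths in the reduced skeleton\<close>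

context k_graph
begin

text \<open>Every morphism is a composite of edges: split off one edge at a time.\<close>

lemma ex_path_eval:
  assumes "l \<in> Mor \<Lambda>"
  shows "\<exists>fs. walk (one_skeleton \<Lambda> d) (Cod \<Lambda> l) fs \<and> path_eval \<Lambda> (Cod \<Lambda> l, fs) = l"
  using assms
proof (induction "deg_size (d l)" arbitrary: l)
  case 0
  then have "d l = 0" by (simp add: deg_size_def vec_eq_iff)
  then have "l \<in> Ident \<Lambda> ` Obj \<Lambda>"
    using bij_betw_imp_surj_on[OF bij_betw_Ident_degree_zero] 0 by auto
  then obtain a where "a \<in> Obj \<Lambda>" "l = Ident \<Lambda> a" by auto
  then show ?case
    by (intro exI[of _ "[]"]) (simp add: one_skeleton_def C.Cod_Ident)
next
  case (Suc n)
  then obtain i where i: "d l $ i \<noteq> 0"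
    by (metis deg_size_def nat.distinct(1) sum.neutral)
  have split: "d l = (d l - axis i 1) + axis i 1"
    using i by (simp add: vec_eq_iff axis_def)
  obtain f g where f: "f \<in> Mor \<Lambda>" "d f = axis i 1" and g: "g \<in> Mor \<Lambda>" "d g = d l - axis i 1"
    and c: "Dom \<Lambda> f = Cod \<Lambda> g" and l: "l = Comp \<Lambda> f g"
    using factorization[OF Suc.prems split] by auto
  have one: "deg_size (d f) = 1" using f by (simp add: deg_size_eq_1 del: One_nat_def)
  have "deg_size (d l) = deg_size (d g) + deg_size (d f)"
    by (subst split) (simp add: f g deg_size_def sum.distrib)
  then have "n = deg_size (d g)" using Suc.hyps(2) one by simp
  then obtain fs where "walk (one_skeleton \<Lambda> d) (Cod \<Lambda> g) fs" "path_eval \<Lambda> (Cod \<Lambda> g, fs) = g"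
    using Suc.hyps(1) g by blast
  then show ?case
    using f one c l C.Cod_Comp[OF f(1) g(1) c]
    by (intro exI[of _ "f # fs"]) (simp add: one_skeleton_def)
qed

text \<open>
  A walk with surviving range passes only through surviving vertices, because the source of a
  surviving edge survives.
\<close>

lemma walk_sink_del_skeleton:
  assumes "walk (one_skeleton \<Lambda> d) w fs" "w \<in> verts (sink_del_skeleton \<Lambda> d v)"
  shows "walk (sink_del_skeleton \<Lambda> d v) w fs"
  using assms
proof (induction fs arbitrary: w)
  case (Cons f fs)
  have f: "f \<in> edges (sink_del_skeleton \<Lambda> d v)"
    using Cons.prems by (auto simp: sink_del_skeleton_def Let_def)
  then have "src (sink_del_skeleton \<Lambda> d v) f \<in> verts (sink_del_skeleton \<Lambda> d v)"
    by (rule coloured_graph.src_in[OF coloured_graph_sink_del_skeleton])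
  moreover have "src (sink_del_skeleton \<Lambda> d v) f = src (one_skeleton \<Lambda> d) f"
    "rng (sink_del_skeleton \<Lambda> d v) f = rng (one_skeleton \<Lambda> d) f"
    by (simp_all add: sink_del_skeleton_def Let_def)
  ultimately show ?case
    using Cons f by simp
qed simp

lemma path_eval_functor:
  "cat_functor (path_cat (sink_del_skeleton \<Lambda> d v)) \<Lambda> (\<lambda>w. w) (path_eval \<Lambda>)"
proof -
  let ?G = "one_skeleton \<Lambda> d" and ?S = "sink_del_skeleton \<Lambda> d v"
  let ?P = "path_cat ?S"
  interpret P: category ?P
    using category_path_cat coloured_graph_sink_del_skeleton by blast
  have src_eq: "path_src ?S p = path_src ?G p" for p :: "('o, 'm) gpath"
    by (simp add: path_src_def sink_del_skeleton_def Let_def)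
  have w: "walk ?G (fst p) (snd p)" if "p \<in> Mor ?P" for p
    using sink_del_path_in_skeleton[OF that] by (auto simp: path_cat_def)
  show ?thesis
  proof unfold_locales
    fix p q assume pq: "p \<in> Mor ?P" "q \<in> Mor ?P" "Dom ?P p = Cod ?P q"
    then have "path_src ?G (fst p, snd p) = fst q"
      by (simp add: path_cat_def path_rng_def src_eq)
    then show "path_eval \<Lambda> (Comp ?P p q) = Comp \<Lambda> (path_eval \<Lambda> p) (path_eval \<Lambda> q)"
      using path_eval_append[of "fst p" "snd p" "snd q"] w[OF pq(1)] w[OF pq(2)]
      by (simp add: path_cat_def)
  next
    fix p assume "p \<in> Mor ?P"
    from path_eval_walk[OF w[OF this]]
    show "path_eval \<Lambda> p \<in> Mor \<Lambda>" "Dom \<Lambda> (path_eval \<Lambda> p) = Dom ?P p"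
      "Cod \<Lambda> (path_eval \<Lambda> p) = Cod ?P p"
      by (simp_all add: path_cat_def path_rng_def src_eq)
  next
    fix a assume "a \<in> Obj ?P"
    then show "a \<in> Obj \<Lambda>" "path_eval \<Lambda> (Ident ?P a) = Ident \<Lambda> a"
      by (simp_all add: path_cat_def sink_del_skeleton_def one_skeleton_def)
  qed
qed

lemma path_eval_image:
  "path_eval \<Lambda> ` Mor (path_cat (sink_del_skeleton \<Lambda> d v)) =
    {l \<in> Mor \<Lambda>. Cod \<Lambda> l \<in> verts (sink_del_skeleton \<Lambda> d v)}" (is "_ ` Mor ?P = ?R")
proof
  interpret E: cat_functor ?P \<Lambda> "\<lambda>w. w" "path_eval \<Lambda>" by (rule path_eval_functor)
  show "path_eval \<Lambda> ` Mor ?P \<subseteq> ?R"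
    using E.Fm_in E.Cod_Fm E.C.Cod_in by (auto simp: path_cat_def)
  show "?R \<subseteq> path_eval \<Lambda> ` Mor ?P"
  proof
    fix l assume l: "l \<in> ?R"
    then obtain fs where fs: "walk (one_skeleton \<Lambda> d) (Cod \<Lambda> l) fs"
        "path_eval \<Lambda> (Cod \<Lambda> l, fs) = l"
      using ex_path_eval by blast
    then have "(Cod \<Lambda> l, fs) \<in> Mor ?P"
      using walk_sink_del_skeleton[of "Cod \<Lambda> l" fs v] l by (simp add: path_cat_def)
    then show "l \<in> path_eval \<Lambda> ` Mor ?P" using fs by (metis imageI)
  qed
qed

lemma path_eval_degree:
  assumes "p \<in> Mor (path_cat (sink_del_skeleton \<Lambda> d v))"
  shows "d (path_eval \<Lambda> p) = path_deg (sink_del_skeleton \<Lambda> d v) p"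
  using path_eval_walk[of "fst p" "snd p"] sink_del_path_in_skeleton[OF assms]
  by (auto simp: path_cat_def path_deg_def sink_del_skeleton_def Let_def)

end

section \<open>Deleting a sink\<close>

theorem theorem5p6:
  fixes \<Lambda> :: "('o, 'm) cat" and d :: "'m \<Rightarrow> nat ^ 'k::finite" and v :: 'o
  assumes "k_graph \<Lambda> d"
    and "source_free \<Lambda> d"
    and "v \<in> Obj \<Lambda>"
    and "is_sink \<Lambda> d v"
  shows "k_graph (sink_del \<Lambda> d v) (sink_del_degree \<Lambda> d v) \<and>
    source_free (sink_del \<Lambda> d v) (sink_del_degree \<Lambda> d v)"
proof -
  let ?S = "sink_del_skeleton \<Lambda> d v"
  let ?P = "path_cat ?S"
  let ?F = "\<lambda>X. the_elem (path_eval \<Lambda> ` X)"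
  interpret k_graph \<Lambda> d by fact
  interpret E: cat_functor ?P \<Lambda> "\<lambda>w. w" "path_eval \<Lambda>" by (rule path_eval_functor)
  have inj: "inj_on (\<lambda>w. w) A" for A :: "'o set" by simp
  have R: "sink_del_equiv \<Lambda> d v = kernel_rel ?P (path_eval \<Lambda>)"
    by (simp add: sink_del_equiv_def kernel_rel_def)
  have Q: "sink_del \<Lambda> d v = quotient_cat ?P (kernel_rel ?P (path_eval \<Lambda>))"
    by (simp add: sink_del_def R)
  have fun_F: "cat_functor (sink_del \<Lambda> d v) \<Lambda> (\<lambda>w. w) ?F"
    unfolding Q by (rule E.kernel_quotient_functor[OF inj])
  have inj_F: "inj_on ?F (Mor (sink_del \<Lambda> d v))"
    unfolding Q by (rule E.kernel_quotient_inj[OF inj])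
  have "Obj (sink_del \<Lambda> d v) = verts ?S"
    by (simp add: sink_del_def quotient_cat_def path_cat_def)
  then have img_F: "?F ` Mor (sink_del \<Lambda> d v) =
      {l \<in> Mor \<Lambda>. Cod \<Lambda> l \<in> (\<lambda>w. w) ` Obj (sink_del \<Lambda> d v)}"
    using E.kernel_quotient_image[OF inj] path_eval_image by (simp add: Q)
  have deg_F: "sink_del_degree \<Lambda> d v X = d (?F X)" if X: "X \<in> Mor (sink_del \<Lambda> d v)" for X
  proof -
    obtain p where p: "p \<in> Mor ?P" and X: "X = kernel_rel ?P (path_eval \<Lambda>) `` {p}"
      using X unfolding Q by (rule Mor_kernel_quotientE)
    have "sink_del_degree \<Lambda> d v X = path_deg ?S p"
      unfolding sink_del_degree_def X
      by (rule the_elem_kernel_class[OF p]) (metis p path_eval_degree)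
    also have "\<dots> = d (?F X)"
      unfolding X E.kernel_quotient_class(3)[OF inj p] by (rule path_eval_degree[OF p, symmetric])
    finally show ?thesis .
  qed
  show ?thesis
    using k_graph_of_embedding[OF fun_F inj inj_F img_F deg_F]
      source_free_of_embedding[OF fun_F inj img_F deg_F assms(2)] by simp
qed

end
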